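(* Let $\gamma\ge 1$ and let $n\ge 2N$ for $N\in\mathbb{N}$, $N\ge 1$. For any deterministic fixed-point iteration $\mathbf{A}$ and any initial point $y_0\in\mathbb{R}^n$, there exists a $\frac1\gamma$-Lipschitz operator $\mathbb{T}\colon\mathbb{R}^n\to\mathbb{R}^n$ with a fixed point $y_\star\in\mathrm{Fix}\,\mathbb{T}$ such that \[ \|y_N-\mathbb{T}y_N\|^2\ge\left(1+\frac1\gamma\right)^2\left(\frac{1}{\sum_{k=0}^N\gamma^k}\right)^2\|y_0-y_\star\|^2, \] where $\{y_t\}_{t\in\mathbb{N}}=\mathbf{A}[y_0;\mathbb{T}]$.
   Context: $\mathbb{R}^n$ carries the standard Euclidean norm; $\mathrm{Fix}\,\mathbb{T}=\{y:\mathbb{T}y=y\}$; $\frac1\gamma$-Lipschitz means $\|\mathbb{T}x-\mathbb{T}y\|\le\frac1\gamma\|x-y\|$ for all $x,y$. A deterministic fixed-point iteration $\mathbf{A}=\{\mathbf{A}_t\}_{t\in\mathbb{N}}$ maps an initial point $y_0$ and an operator $\mathbb{T}$ to a sequence of iterates $\{y_t\}_{t\in\mathbb{N}}=\mathbf{A}[y_0;\mathbb{T}]$, depending on $\mathbb{T}$ only through the fixed-point residual oracle $\mathcal{O}_{\mathbb{T}}(y)=y-\mathbb{T}y$ evaluated at previous iterates: each $\mathbf{A}_t$ is a (deterministic) mapping with \[ y_t=\mathbf{A}_t[y_0,\mathcal{O}_{\mathbb{T}}(y_0),\dots,\mathcal{O}_{\mathbb{T}}(y_{t-1})],\qquad t=1,2,\dots.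 \] (Query points and approximate solutions produced by the algorithm are identified.) *)

theory Defs
  imports "HOL-Analysis.Analysis"
begin

definition Fix :: "('a \<Rightarrow> 'a) \<Rightarrow> 'a set" where
  "Fix T = {y. T y = y}"

definition residual :: "('a::ab_group_add \<Rightarrow> 'a) \<Rightarrow> 'a \<Rightarrow> 'a" where
  "residual T y = y - T y"

(* A deterministic fixed-point iteration is an arbitrary family A of maps:
   A t y0 [O(y_0), ..., O(y_(t-1))] is the iterate y_t, for t >= 1.  The values
   A 0 and A t y0 rs with length rs different from t are never used. *)
type_synonym 'a fp_iteration = "nat \<Rightarrow> 'a \<Rightarrow> 'a list \<Rightarrow> 'a"

fun iterates :: "'a::ab_group_add fp_iteration \<Rightarrow> 'a \<Rightarrow> ('a \<Rightarrow> 'a) \<Rightarrow> nat \<Rightarrow> 'a" where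
  "iterates A y0 T 0 = y0"
| "iterates A y0 T (Suc t) =
     A (Suc t) y0 (map (\<lambda>s. residual T (iterates A y0 T s)) [0..<Suc t])"

end

theory Submission
  imports Defs
begin

text \<open>For an orthonormal family \<open>v 0, \<dots>, v N\<close> the map \<open>v 0 \<mapsto> v 1 \<mapsto> \<dots> \<mapsto> v N \<mapsto> - v 0\<close>, scaled by
  \<open>1 / \<gamma>\<close> and shifted by a multiple of \<open>v 0\<close>, is \<open>1 / \<gamma>\<close>-Lipschitz, and each residual reveals at most one
  new direction. Choosing the directions adversarially along the run keeps \<open>v j\<close> orthogonal to all iterates
  queried before \<open>v j\<close> appears, and the sign of \<open>v N\<close> can be chosen so that the last iterate has no positive component
  along it. Pairing
  its residual with \<open>\<Sum>i\<le>N. \<gamma> ^ i *\<^sub>R v i\<close> then gives the bound.\<close>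

section \<open>Orthonormal families\<close>

definition orthonormal_upto :: "nat \<Rightarrow> (nat \<Rightarrow> 'a::real_inner) \<Rightarrow> bool" where
  "orthonormal_upto m v \<longleftrightarrow> (\<forall>i\<le>m. \<forall>j\<le>m. v i \<bullet> v j = (if i = j then 1 else 0))"

lemma orthonormal_uptoD:
  "orthonormal_upto m v \<Longrightarrow> i \<le> m \<Longrightarrow> j \<le> m \<Longrightarrow> v i \<bullet> v j = (if i = j then 1 else 0)"
  by (simp add: orthonormal_upto_def)

lemma orthonormal_upto_Suc:
  "orthonormal_upto (Suc m) (v(Suc m := u)) \<longleftrightarrow>
     orthonormal_upto m v \<and> u \<bullet> u = 1 \<and> (\<forall>i\<le>m. u \<bullet> v i = 0)"
  (is "?L \<longleftrightarrow> ?R")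
proof
  assume L: ?L
  have "v i \<bullet> v j = (if i = j then 1 else 0)" if "i \<le> m" "j \<le> m" for i j
    using orthonormal_uptoD[OF L, of i j] that by simp
  moreover have "u \<bullet> u = 1"
    using orthonormal_uptoD[OF L, of "Suc m" "Suc m"] by simp
  moreover have "u \<bullet> v i = 0" if "i \<le> m" for i
    using orthonormal_uptoD[OF L, of "Suc m" i] that by simp
  ultimately show ?R
    by (simp add: orthonormal_upto_def)
next
  assume ?R
  then have "v i \<bullet> u = 0" if "i \<le> m" for i
    using that by (simp add: inner_commute)
  with \<open>?R\<close> show ?L
    by (auto simp: orthonormal_upto_def le_Suc_eq)
qed

lemma orthonormal_sum_inner:
  assumes "orthonormal_upto m v" "j \<le> m"
  shows "(\<Sum>i\<le>m. a i *\<^sub>R v i) \<bullet> v j = a j"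
proof -
  have "(\<Sum>i\<le>m. a i *\<^sub>R v i) \<bullet> v j = (\<Sum>i\<le>m. if i = j then a i else 0)"
    unfolding inner_sum_left
    by (rule sum.cong) (use assms in \<open>auto simp: orthonormal_uptoD\<close>)
  then show ?thesis
    using assms(2) by simp
qed

lemma orthonormal_sum_norm:
  assumes "orthonormal_upto m v"
  shows "(norm (\<Sum>i\<le>m. a i *\<^sub>R v i))\<^sup>2 = (\<Sum>i\<le>m. (a i)\<^sup>2)"
proof -
  have "(norm (\<Sum>i\<le>m. a i *\<^sub>R v i))\<^sup>2 = (\<Sum>j\<le>m. a j * ((\<Sum>i\<le>m. a i *\<^sub>R v i) \<bullet> v j))"
    by (simp add: power2_norm_eq_inner inner_sum_right)
  also have "\<dots> = (\<Sum>i\<le>m. (a i)\<^sup>2)"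
    using assms by (intro sum.cong) (auto simp: orthonormal_sum_inner power2_eq_square)
  finally show ?thesis .
qed

lemma Bessel_inequality:
  assumes "orthonormal_upto m v"
  shows "(\<Sum>i\<le>m. (v i \<bullet> z)\<^sup>2) \<le> (norm z)\<^sup>2"
proof -
  define p where "p = (\<Sum>i\<le>m. (v i \<bullet> z) *\<^sub>R v i)"
  have pp: "p \<bullet> p = (\<Sum>i\<le>m. (v i \<bullet> z)\<^sup>2)"
    using orthonormal_sum_norm[OF assms] by (simp add: p_def power2_norm_eq_inner)
  have "p \<bullet> z = (\<Sum>i\<le>m. (v i \<bullet> z)\<^sup>2)"
    by (simp add: p_def inner_sum_left power2_eq_square)
  moreover have "0 \<le> (z - p) \<bullet> (z - p)"
    by simp
  ultimately show ?thesis
    using pp by (simp add: power2_norm_eq_inner inner_diff inner_commute)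
qed

text \<open>The old directions and \<open>B\<close> span a proper subspace, which leaves room for a
  unit normal. \<open>B\<close> will hold displacements of iterates from \<open>y0\<close>.\<close>

lemma orthonormal_extend:
  fixes v :: "nat \<Rightarrow> 'a::euclidean_space"
  assumes v: "orthonormal_upto m v"
    and B: "finite B" "card B + Suc m < DIM('a)"
  obtains u where "orthonormal_upto (Suc m) (v(Suc m := u))" "\<And>x. x \<in> B \<Longrightarrow> u \<bullet> x = 0"
proof -
  let ?S = "v ` {..m} \<union> B"
  have "card ?S \<le> Suc m + card B"
    using card_Un_le[of "v ` {..m}" B] card_image_le[of "{..m}" v] by simp
  then have "dim ?S < DIM('a)"
    using dim_le_card'[of ?S] B by simp
  then obtain x where x: "x \<noteq> 0" "\<And>y. y \<in> span ?S \<Longrightarrow> orthogonal x y"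
    using orthogonal_to_subspace_exists by metis
  then have perp: "sgn x \<bullet> y = 0" if "y \<in> ?S" for y
    using that span_base[of y ?S] by (auto simp: sgn_div_norm orthogonal_def)
  have unit: "sgn x \<bullet> sgn x = 1"
    using x(1) by (simp add: norm_sgn dot_square_norm)
  show thesis
  proof
    show "orthonormal_upto (Suc m) (v(Suc m := sgn x))"
      using v perp unit by (simp add: orthonormal_upto_Suc)
  qed (use perp in auto)
qed

lemma ex_unit_vector: "\<exists>v. orthonormal_upto 0 (v :: nat \<Rightarrow> 'a::euclidean_space)"
proof -
  obtain b :: 'a where "b \<in> Basis"
    using nonempty_Basis by blast
  then show ?thesis
    by (intro exI[of _ "\<lambda>_. b"]) (simp add: orthonormal_upto_def)
qed

section \<open>Dependence of the iterates on the oracle\<close>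

text \<open>An iterate uses only residuals at strictly earlier times, so agreement before time
  \<open>t\<close> settles iterate \<open>t\<close> too. This lets the operator be revised after
  queries have been answered.\<close>

lemma iterates_cong:
  assumes "\<And>s. s < t \<Longrightarrow> T (iterates A y0 T s) = T' (iterates A y0 T s)"
  shows "s \<le> t \<Longrightarrow> iterates A y0 T' s = iterates A y0 T s"
proof (induction s rule: less_induct)
  case (less s)
  show ?case
  proof (cases s)
    case (Suc r)
    have "map (\<lambda>q. residual T' (iterates A y0 T' q)) [0..<Suc r] =
          map (\<lambda>q. residual T (iterates A y0 T q)) [0..<Suc r]"
    proof (rule map_cong)
      fix q assume "q \<in> set [0..<Suc r]"
      then have "q < s" "q < t"
        using Suc less.prems by auto
      then show "residual T' (iterates A y0 T' q) = residual T (iterates A y0 T q)"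
        using less.IH[of q] assms[of q] by (simp add: residual_def)
    qed simp
    then show ?thesis
      unfolding Suc iterates.simps by (rule arg_cong)
  qed simp
qed

section \<open>The hard operator\<close>

text \<open>The part of the cycle committed to so far: the link out of \<open>v m\<close> is still
  open.\<close>

definition chain_op :: "'a::real_inner \<Rightarrow> real \<Rightarrow> real \<Rightarrow> (nat \<Rightarrow> 'a) \<Rightarrow> nat \<Rightarrow> 'a \<Rightarrow> 'a" where
  "chain_op y0 b \<gamma> v m y =
     y0 + b *\<^sub>R v 0 + (1 / \<gamma>) *\<^sub>R (\<Sum>i<m. (v i \<bullet> (y - y0)) *\<^sub>R v (Suc i))"

text \<open>The minus sign makes \<open>\<gamma> ^ m + 1 / \<gamma>\<close> the shift that fits the
  fixed point below; a plus sign would need \<open>\<gamma> ^ m - 1 / \<gamma>\<close>, which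
  vanishes at \<open>\<gamma> = 1\<close>.\<close>

definition cycle_op :: "'a::real_inner \<Rightarrow> real \<Rightarrow> real \<Rightarrow> (nat \<Rightarrow> 'a) \<Rightarrow> nat \<Rightarrow> 'a \<Rightarrow> 'a" where
  "cycle_op y0 b \<gamma> v m y = chain_op y0 b \<gamma> v m y - ((v m \<bullet> (y - y0)) / \<gamma>) *\<^sub>R v 0"

text \<open>The new link starts at \<open>v m\<close>, so points without a \<open>v m\<close>
  component do not see it: earlier oracle answers survive the choice of \<open>u\<close>.\<close>

lemma chain_op_extend:
  assumes "v m \<bullet> (y - y0) = 0"
  shows "chain_op y0 b \<gamma> (v(Suc m := u)) (Suc m) y = chain_op y0 b \<gamma> v m y"
proof -
  have "(\<Sum>i<m. ((v(Suc m := u)) i \<bullet> (y - y0)) *\<^sub>R (v(Suc m := u)) (Suc i)) =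
        (\<Sum>i<m. (v i \<bullet> (y - y0)) *\<^sub>R v (Suc i))"
    by (rule sum.cong) auto
  then show ?thesis
    using assms by (simp add: chain_op_def)
qed

text \<open>The linear part is \<open>1 / \<gamma>\<close> times a map that carries one orthonormal
  family to another and kills the orthogonal complement; Bessel's inequality makes that map
  nonexpansive.\<close>

lemma cycle_op_lipschitz:
  assumes v: "orthonormal_upto m v" and "\<gamma> > 0"
  shows "(1 / \<gamma>)-lipschitz_on UNIV (cycle_op y0 b \<gamma> v m)"
proof (rule lipschitz_onI)
  fix x y :: 'a
  define w where "w i = (if i < m then v (Suc i) else - v 0)" for i
  have w: "orthonormal_upto m w"
    using v by (auto simp: orthonormal_upto_def w_def)
  let ?M = "\<lambda>z. (\<Sum>i\<le>m. (v i \<bullet> z) *\<^sub>R w i)"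
  have M: "?M z = (\<Sum>i<m. (v i \<bullet> z) *\<^sub>R v (Suc i)) - (v m \<bullet> z) *\<^sub>R v 0" for z
    by (simp add: w_def lessThan_Suc_atMost[symmetric])
  have cyc: "cycle_op y0 b \<gamma> v m y = y0 + b *\<^sub>R v 0 + (1 / \<gamma>) *\<^sub>R ?M (y - y0)" for y
    unfolding M by (simp add: cycle_op_def chain_op_def algebra_simps diff_divide_distrib)
  have "?M (x - y0) - ?M (y - y0) = ?M (x - y)"
    by (simp add: sum_subtractf[symmetric] algebra_simps inner_diff_right)
  then have diff: "cycle_op y0 b \<gamma> v m x - cycle_op y0 b \<gamma> v m y = (1 / \<gamma>) *\<^sub>R ?M (x - y)"
    unfolding cyc by (simp add: scaleR_diff_right[symmetric] del: scaleR_scaleR)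
  have "(norm (?M (x - y)))\<^sup>2 \<le> (norm (x - y))\<^sup>2"
    unfolding orthonormal_sum_norm[OF w] by (rule Bessel_inequality[OF v])
  then have "norm (?M (x - y)) \<le> norm (x - y)"
    by (rule power2_le_imp_le) simp
  then show "dist (cycle_op y0 b \<gamma> v m x) (cycle_op y0 b \<gamma> v m y) \<le> 1 / \<gamma> * dist x y"
    using \<open>\<gamma> > 0\<close> unfolding dist_norm diff by (simp add: divide_right_mono)
qed (use \<open>\<gamma> > 0\<close> in simp)

text \<open>Each link divides the coordinate by \<open>\<gamma>\<close>, down to 1 at
  \<open>v m\<close>. The closing link then leaves the shift minus \<open>1 / \<gamma>\<close> along
  \<open>v 0\<close>, which is \<open>\<gamma> ^ m\<close> as required.\<close>

lemma cycle_op_fixed_point: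
  assumes v: "orthonormal_upto m v" and "\<gamma> > 0"
  shows "y0 + (\<Sum>i\<le>m. \<gamma> ^ (m - i) *\<^sub>R v i) \<in> Fix (cycle_op y0 (\<gamma> ^ m + 1 / \<gamma>) \<gamma> v m)"
proof -
  define z where "z = (\<Sum>i\<le>m. \<gamma> ^ (m - i) *\<^sub>R v i)"
  have vz: "v i \<bullet> z = \<gamma> ^ (m - i)" if "i \<le> m" for i
    using orthonormal_sum_inner[OF v that] by (simp add: z_def inner_commute)
  have "(1 / \<gamma>) *\<^sub>R (\<Sum>i<m. (v i \<bullet> z) *\<^sub>R v (Suc i)) = (\<Sum>i<m. \<gamma> ^ (m - Suc i) *\<^sub>R v (Suc i))"
    unfolding scaleR_sum_right
  proof (rule sum.cong)
    fix i assume "i \<in> {..<m}"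
    then have "\<gamma> ^ (m - i) = \<gamma> * \<gamma> ^ (m - Suc i)"
      by (metis Suc_diff_Suc lessThan_iff power_Suc)
    with \<open>i \<in> {..<m}\<close> \<open>\<gamma> > 0\<close>
    show "(1 / \<gamma>) *\<^sub>R (v i \<bullet> z) *\<^sub>R v (Suc i) = \<gamma> ^ (m - Suc i) *\<^sub>R v (Suc i)"
      by (simp add: vz)
  qed simp
  also have "\<dots> = z - \<gamma> ^ m *\<^sub>R v 0"
    unfolding z_def by (simp add: sum.atMost_shift)
  finally show ?thesis
    by (simp add: Fix_def cycle_op_def chain_op_def vz algebra_simps flip: z_def)
qed

lemma cycle_op_residual_bound:
  assumes v: "orthonormal_upto m v" and "\<gamma> > 0"
    and sign: "v m \<bullet> (y - y0) \<le> 0"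
  shows "(\<gamma> ^ m + 1 / \<gamma>)\<^sup>2 \<le>
    (\<Sum>i\<le>m. (\<gamma> ^ i)\<^sup>2) * (norm (y - cycle_op y0 (\<gamma> ^ m + 1 / \<gamma>) \<gamma> v m y))\<^sup>2"
proof -
  \<comment> \<open>Apart from the shift, residuals at points without \<open>v m\<close> and orthogonal components lie in the
    span of the vectors \<open>v i - (1 / \<gamma>) *\<^sub>R v (Suc i)\<close>, all of which are orthogonal to \<open>w\<close>.\<close>
  define w where "w = (\<Sum>i\<le>m. \<gamma> ^ i *\<^sub>R v i)"
  define b where "b = \<gamma> ^ m + 1 / \<gamma>"
  let ?z = "y - y0" and ?r = "y - cycle_op y0 b \<gamma> v m y"
  have wv: "w \<bullet> v i = \<gamma> ^ i" if "i \<le> m" for i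
    using orthonormal_sum_inner[OF v that] by (simp add: w_def)
  have "w \<bullet> (\<Sum>i<m. (v i \<bullet> ?z) *\<^sub>R v (Suc i)) = (\<Sum>i<m. (v i \<bullet> ?z) * \<gamma> ^ Suc i)"
    unfolding inner_sum_right by (rule sum.cong) (auto simp: wv)
  also have "\<dots> = \<gamma> * (\<Sum>i<m. \<gamma> ^ i * (v i \<bullet> ?z))"
    by (simp add: sum_distrib_left mult_ac)
  finally have chain: "w \<bullet> (\<Sum>i<m. (v i \<bullet> ?z) *\<^sub>R v (Suc i)) = \<gamma> * (\<Sum>i<m. \<gamma> ^ i * (v i \<bullet> ?z))" .
  have wz: "w \<bullet> ?z = (\<Sum>i<m. \<gamma> ^ i * (v i \<bullet> ?z)) + \<gamma> ^ m * (v m \<bullet> ?z)"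
    unfolding w_def inner_sum_left by (simp add: lessThan_Suc_atMost[symmetric])
  have "?r = ?z - b *\<^sub>R v 0 - (1 / \<gamma>) *\<^sub>R (\<Sum>i<m. (v i \<bullet> ?z) *\<^sub>R v (Suc i))
      + ((v m \<bullet> ?z) / \<gamma>) *\<^sub>R v 0"
    by (simp add: cycle_op_def chain_op_def)
  then have "w \<bullet> ?r = w \<bullet> ?z - b - (1 / \<gamma>) * (w \<bullet> (\<Sum>i<m. (v i \<bullet> ?z) *\<^sub>R v (Suc i)))
      + (v m \<bullet> ?z) / \<gamma>"
    using wv[of 0] by (simp only: inner_add_right inner_diff_right inner_scaleR_right) simp
  \<comment> \<open>The sums over \<open>i < m\<close> cancel; \<open>\<gamma> ^ m\<close> from
    \<open>wz\<close> and \<open>1 / \<gamma>\<close> from the closing link add up to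
    \<open>b\<close> again.\<close>
  also have "\<dots> = b * (v m \<bullet> ?z) - b"
    using \<open>\<gamma> > 0\<close> unfolding wz chain by (simp add: b_def field_simps)
  finally have wr: "w \<bullet> ?r = b * (v m \<bullet> ?z) - b" .
  have b: "b > 0"
    using \<open>\<gamma> > 0\<close> by (simp add: b_def add_pos_pos)
  then have "b * (v m \<bullet> ?z) \<le> 0"
    using sign by (simp add: mult_nonneg_nonpos)
  then have "b \<le> \<bar>w \<bullet> ?r\<bar>"
    unfolding wr by simp
  also have "\<dots> \<le> norm w * norm ?r"
    by (rule Cauchy_Schwarz_ineq2)
  finally have "b\<^sup>2 \<le> (norm w * norm ?r)\<^sup>2"
    using b by (intro power_mono) auto
  also have "\<dots> = (\<Sum>i\<le>m. (\<gamma> ^ i)\<^sup>2) * (norm ?r)\<^sup>2"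
    unfolding power_mult_distrib w_def orthonormal_sum_norm[OF v] ..
  finally show ?thesis
    unfolding b_def .
qed

section \<open>Adversarial choice of the directions\<close>

text \<open>The iterate at time \<open>j\<close> depends on \<open>v 0, \<dots>, v (j - 1)\<close> only, so \<open>v j\<close> may be chosen after it.\<close>

lemma resisting_chain:
  fixes A :: "'a::euclidean_space fp_iteration"
  assumes "2 * t < DIM('a)"
  shows "\<exists>v. orthonormal_upto t v \<and>
    (\<forall>s j. s \<le> j \<longrightarrow> j \<le> t \<longrightarrow> v j \<bullet> (iterates A y0 (chain_op y0 b \<gamma> v t) s - y0) = 0)"
  using assms
proof (induction t)
  case 0
  then show ?case
    using ex_unit_vector by auto
next
  case (Suc t)
  then obtain v where v: "orthonormal_upto t v"
    and perp: "\<And>s j. s \<le> j \<Longrightarrow> j \<le> t \<Longrightarrow> v j \<bullet> (iterates A y0 (chain_op y0 b \<gamma> v t) s - y0) = 0"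
    by auto
  let ?y = "iterates A y0 (chain_op y0 b \<gamma> v t)"
  \<comment> \<open>Time 0 is left out because its displacement is zero. At most
    \<open>Suc t\<close> vectors join the \<open>Suc t\<close> old directions, which fits
    \<open>2 * Suc t < DIM('a)\<close>.\<close>
  let ?B = "(\<lambda>s. ?y s - y0) ` {1..Suc t}"
  have "card ?B \<le> Suc t"
    using card_image_le[of "{1..Suc t}" "\<lambda>s. ?y s - y0"] by simp
  then obtain u where u: "orthonormal_upto (Suc t) (v(Suc t := u))" "\<And>x. x \<in> ?B \<Longrightarrow> u \<bullet> x = 0"
    using orthonormal_extend[OF v, of ?B] Suc.prems by auto
  let ?v = "v(Suc t := u)"
  \<comment> \<open>Iterates up to time \<open>t\<close> have no \<open>v t\<close> component, so
    the link from \<open>v t\<close> to \<open>u\<close> leaves their residuals unchanged.\<close>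
  have same: "iterates A y0 (chain_op y0 b \<gamma> ?v (Suc t)) s = ?y s" if "s \<le> Suc t" for s
    by (rule iterates_cong[OF _ that]) (use perp in \<open>auto simp: chain_op_extend\<close>)
  have new: "u \<bullet> (?y s - y0) = 0" if "s \<le> Suc t" for s
    using u(2)[of "?y s - y0"] that by (cases "s = 0") auto
  show ?case
  proof (intro exI conjI allI impI)
    fix s j assume "s \<le> j" "j \<le> Suc t"
    then show "?v j \<bullet> (iterates A y0 (chain_op y0 b \<gamma> ?v (Suc t)) s - y0) = 0"
      using same[of s] new[of s] perp[of s j] by (auto simp: le_Suc_eq)
  qed (rule u(1))
qed

text \<open>The last direction need not be orthogonal to the last iterate: adjusting its sign suffices.
  This saves one dimension.\<close>

lemma resisting_cycle:
  fixes A :: "'a::euclidean_space fp_iteration"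
  assumes "N \<ge> 1" "2 * N \<le> DIM('a)"
  obtains v where "orthonormal_upto N v"
    "v N \<bullet> (iterates A y0 (cycle_op y0 b \<gamma> v N) N - y0) \<le> 0"
proof -
  obtain t where N: "N = Suc t"
    using \<open>N \<ge> 1\<close> by (cases N) auto
  then obtain v where v: "orthonormal_upto t v"
    and perp: "\<And>s j. s \<le> j \<Longrightarrow> j \<le> t \<Longrightarrow> v j \<bullet> (iterates A y0 (chain_op y0 b \<gamma> v t) s - y0) = 0"
    using resisting_chain[of t A y0 b \<gamma>] assms by auto
  let ?y = "iterates A y0 (chain_op y0 b \<gamma> v t)"
  \<comment> \<open>Iterate \<open>N\<close> is excluded, so at most
    \<open>t + Suc t = 2 * N - 1\<close> vectors must be avoided, which fits even if
    \<open>DIM('a) = 2 * N\<close>.\<close>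
  let ?B = "(\<lambda>s. ?y s - y0) ` {1..t}"
  have "card ?B \<le> t"
    using card_image_le[of "{1..t}" "\<lambda>s. ?y s - y0"] by simp
  then obtain u where u: "orthonormal_upto (Suc t) (v(Suc t := u))" "\<And>x. x \<in> ?B \<Longrightarrow> u \<bullet> x = 0"
    using orthonormal_extend[OF v, of ?B] assms N by auto
  \<comment> \<open>No circularity: \<open>?y N\<close> comes from the chain ending at
    \<open>v t\<close>, before \<open>u\<close> is chosen.\<close>
  define u' where "u' = (if u \<bullet> (?y N - y0) \<le> 0 then u else - u)"
  let ?v = "v(Suc t := u')"
  have new: "u' \<bullet> (?y s - y0) = 0" if "s \<le> t" for s
    using u(2)[of "?y s - y0"] that by (cases "s = 0") (auto simp: u'_def)
  \<comment> \<open>At iterates up to time \<open>t\<close> neither the link out of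
    \<open>v t\<close> nor the closing link contributes, whichever sign was picked.\<close>
  have "iterates A y0 (cycle_op y0 b \<gamma> ?v N) N = ?y N"
    by (rule iterates_cong[OF _ order_refl])
       (use perp new in \<open>auto simp: N cycle_op_def chain_op_extend less_Suc_eq_le
         simp del: iterates.simps(2)\<close>)
  then have "?v N \<bullet> (iterates A y0 (cycle_op y0 b \<gamma> ?v N) N - y0) \<le> 0"
    by (simp add: N u'_def del: iterates.simps(2))
  moreover have "orthonormal_upto N ?v"
    using u(1) unfolding N by (simp add: orthonormal_upto_Suc u'_def del: iterates.simps(2))
  ultimately show thesis
    using that by blast
qed

text \<open>Multiplied by \<open>1 - \<gamma>\<close>, both sides become
  \<open>1 - \<gamma> ^ (2 * Suc N)\<close>. This trades the Cauchy-Schwarz constant for the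
  geometric sum in the bound.\<close>

lemma geometric_sum_even_odd:
  fixes \<gamma> :: real
  shows "(\<gamma> ^ Suc N + 1) * (\<Sum>k\<le>N. \<gamma> ^ k) = (\<gamma> + 1) * (\<Sum>k\<le>N. (\<gamma> ^ k)\<^sup>2)"
proof (cases "\<gamma> = 1")
  case False
  define p where "p = \<gamma> ^ Suc N"
  have G: "(1 - \<gamma>) * (\<Sum>k\<le>N. \<gamma> ^ k) = 1 - p"
    unfolding p_def by (rule sum_gp_basic)
  have "(1 - \<gamma>\<^sup>2) * (\<Sum>k\<le>N. (\<gamma>\<^sup>2) ^ k) = 1 - (\<gamma>\<^sup>2) ^ Suc N"
    by (rule sum_gp_basic)
  then have S: "(1 - \<gamma>\<^sup>2) * (\<Sum>k\<le>N. (\<gamma> ^ k)\<^sup>2) = 1 - p\<^sup>2"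
    unfolding p_def by (simp only: power_mult[symmetric] mult.commute)
  have "(1 - \<gamma>) * ((p + 1) * (\<Sum>k\<le>N. \<gamma> ^ k)) = (p + 1) * (1 - p)"
    unfolding G[symmetric] by (simp only: mult_ac)
  also have "\<dots> = (1 - \<gamma>\<^sup>2) * (\<Sum>k\<le>N. (\<gamma> ^ k)\<^sup>2)"
    unfolding S by (simp add: power2_eq_square algebra_simps)
  also have "\<dots> = (1 - \<gamma>) * ((\<gamma> + 1) * (\<Sum>k\<le>N. (\<gamma> ^ k)\<^sup>2))"
    by (simp add: power2_eq_square algebra_simps)
  finally show ?thesis
    using False by (simp add: p_def)
qed simp

theorem theorem4p6:
  fixes \<gamma> :: real
    and N :: nat
    and A :: "(real ^ 'n) fp_iteration"
    and y0 :: "real ^ 'n"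
  assumes "\<gamma> \<ge> 1"
    and "N \<ge> 1"
    and "CARD('n) \<ge> 2 * N"
  shows "\<exists>(T :: real ^ 'n \<Rightarrow> real ^ 'n) ystar.
           (1 / \<gamma>)-lipschitz_on UNIV T \<and> ystar \<in> Fix T \<and> ystar \<noteq> y0 \<and>
           (norm (iterates A y0 T N - T (iterates A y0 T N)))\<^sup>2
             \<ge> (1 + 1 / \<gamma>)\<^sup>2 * (1 / (\<Sum>k = 0..N. \<gamma> ^ k))\<^sup>2 * (norm (y0 - ystar))\<^sup>2"
proof -
  define b where "b = \<gamma> ^ N + 1 / \<gamma>"
  have \<gamma>: "\<gamma> > 0"
    using assms(1) by simp
  obtain v where v: "orthonormal_upto N v"
    and sign: "v N \<bullet> (iterates A y0 (cycle_op y0 b \<gamma> v N) N - y0) \<le> 0"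
    using resisting_cycle[of N A y0 b \<gamma>] assms(2,3) by auto
  let ?T = "cycle_op y0 b \<gamma> v N"
  let ?r = "iterates A y0 ?T N - ?T (iterates A y0 ?T N)"
  define z where "z = (\<Sum>i\<le>N. \<gamma> ^ (N - i) *\<^sub>R v i)"
  define S where "S = (\<Sum>k\<le>N. (\<gamma> ^ k)\<^sup>2)"
  define G where "G = (\<Sum>k\<le>N. \<gamma> ^ k)"
  \<comment> \<open>Up to reversing the exponents, \<open>z\<close> has the coefficients of the
    vector paired with the residual, so both have squared norm \<open>S\<close>.\<close>
  have z: "(norm z)\<^sup>2 = S"
    unfolding z_def S_def orthonormal_sum_norm[OF v]
    by (rule sum.reindex_bij_witness[of _ "\<lambda>i. N - i" "\<lambda>i. N - i"]) auto
  have pos: "S > 0" "G > 0"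
    using \<gamma> by (auto simp: S_def G_def intro!: sum_pos)
  have bG: "b * G = (1 + 1 / \<gamma>) * S"
    using geometric_sum_even_odd[of \<gamma> N] \<gamma>
    by (simp add: b_def G_def S_def field_simps)
  \<comment> \<open>\<open>S\<close> enters twice, as squared distance to the fixed point and as
    Cauchy-Schwarz factor; multiplying by it completes the square of \<open>b\<close>.\<close>
  have "((1 + 1 / \<gamma>)\<^sup>2 * (1 / G)\<^sup>2 * S) * S = ((1 + 1 / \<gamma>) * S / G)\<^sup>2"
    by (simp add: power_mult_distrib power_divide power2_eq_square)
  also have "\<dots> = b\<^sup>2"
    using bG pos(2) by (simp flip: bG)
  also have "\<dots> \<le> (norm ?r)\<^sup>2 * S"
    using cycle_op_residual_bound[OF v \<gamma> sign[unfolded b_def]]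
    by (simp add: b_def S_def mult.commute)
  finally have "(1 + 1 / \<gamma>)\<^sup>2 * (1 / G)\<^sup>2 * S \<le> (norm ?r)\<^sup>2"
    using pos(1) by simp
  then have "(1 + 1 / \<gamma>)\<^sup>2 * (1 / (\<Sum>k = 0..N. \<gamma> ^ k))\<^sup>2 * (norm (y0 - (y0 + z)))\<^sup>2 \<le> (norm ?r)\<^sup>2"
    by (simp add: z G_def atMost_atLeast0)
  moreover have "y0 + z \<in> Fix ?T"
    unfolding z_def b_def by (rule cycle_op_fixed_point[OF v \<gamma>])
  moreover have "y0 + z \<noteq> y0"
    using z pos(1) by auto
  ultimately show ?thesis
    using cycle_op_lipschitz[OF v \<gamma>] by blast
qed

end
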